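(* Let $C$ be a command and $\omega$ a finite non-empty word. If $C \overset{\omega}{\twoheadrightarrow} C'$ then there exists a finite configuration $x$ of the event structure $[\![C]\!]$ such that there is a covering chain $\emptyset \subset x_1 \subset \dots \subset x_n = x$, each step adding one event, whose sequence of added events (read through their labels) is $\omega$.
   Context: Commands over a set of atomic actions $Act$: $C ::= \mathtt{skip} \mid a \in Act \mid C;C \mid C + C \mid C \parallel C$. Labels are $L = Act\cup\{sk\}$, and $\checkmark$ denotes a terminated computation. Small-step rules: $\mathtt{skip}\xrightarrow{sk}\checkmark$, $a\xrightarrow{a}\checkmark$; if $C_1\xrightarrow{l}\checkmark$ then $C_1;C_2\xrightarrow{l}C_2$, and if $C_1\xrightarrow{l}C_1'$ then $C_1;C_2\xrightarrow{l}C_1';C_2$; $C_1+C_2$ makes any move of $C_1$ or of $C_2$ (to $\checkmark$ or the residual of that component, discarding the other); $C_1\parallel C_2$ interleaves: a move of $C_i$ to $C_i'$ gives the parallel composition with $C_i$ replaced by $C_i'$, and a move of $C_i$ to $\checkmark$ leaves the other component. A word is a finite non-empty sequence of labels; $C\overset{l}{\twoheadrightarrow}C'$ if $C\xrightarrow{l}C'$, and $C\overset{l:\omega'}{\twoheadrightarrow}C'$ if $C\xrightarrow{l}C''$ and $C''\overset{\omega'}{\twoheadrightarrow}C'$. An event structure $(E,\le,\#)$ has a partial order $\le$ with finite down-closures and an irreflexive symmetric conflict relation $\#$ with $e\#e'\le e''\Rightarrow e\#e''$. A configuration is a conflict-free, down-closed subset of $E$; a covering chain of $x$ is a sequence $\emptyset\subset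 x_1\subset\cdots\subset x_n=x$ of finite configurations each adding exactly one event. The interpretation $[\![C]\!]$: $[\![\mathtt{skip}]\!]$ and $[\![a]\!]$ are one-event structures with event $sk$, resp. $a$; $[\![C_1;C_2]\!]$ has events $E_1\uplus(E_2\times \mathcal{C}^{max}([\![C_1]\!]))$ (copies $(e_2,x)$ of $E_2$-events for each maximal configuration $x$ of $[\![C_1]\!]$), order from both components plus $e_1\le(e_2,x)$ whenever $e_1\in x$, conflict inherited from $E_1$ downward and within each copy of $E_2$; $[\![C_1+C_2]\!]$ is the disjoint union with every event of $[\![C_1]\!]$ in conflict with every event of $[\![C_2]\!]$; $[\![C_1\parallel C_2]\!]$ is the disjoint union with no extra order or conflict. Events (and their copies) carry the label of the action they come from. *)

theory Defs
  imports "HOL-Library.FSet"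
begin

section \<open>Commands and their small-step semantics\<close>

datatype 'a com =
    Skip
  | Act 'a
  | Seq "'a com" "'a com"
  | Choice "'a com" "'a com"
  | Par "'a com" "'a com"

datatype 'a label = Sk | Lab 'a

datatype 'a outcome = Tick | Run "'a com"

inductive step :: "'a com \<Rightarrow> 'a label \<Rightarrow> 'a outcome \<Rightarrow> bool" where
  skip: "step Skip Sk Tick"
| act: "step (Act a) (Lab a) Tick"
| seq_tick: "step C1 l Tick \<Longrightarrow> step (Seq C1 C2) l (Run C2)"
| seq_run: "step C1 l (Run C1') \<Longrightarrow> step (Seq C1 C2) l (Run (Seq C1' C2))"
| choice_left: "step C1 l D \<Longrightarrow> step (Choice C1 C2) l D"
| choice_right: "step C2 l D \<Longrightarrow> step (Choice C1 C2) l D"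
| par_left_run: "step C1 l (Run C1') \<Longrightarrow> step (Par C1 C2) l (Run (Par C1' C2))"
| par_left_tick: "step C1 l Tick \<Longrightarrow> step (Par C1 C2) l (Run C2)"
| par_right_run: "step C2 l (Run C2') \<Longrightarrow> step (Par C1 C2) l (Run (Par C1 C2'))"
| par_right_tick: "step C2 l Tick \<Longrightarrow> step (Par C1 C2) l (Run C1)"

inductive steps :: "'a com \<Rightarrow> 'a label list \<Rightarrow> 'a outcome \<Rightarrow> bool" where
  single: "step C l D \<Longrightarrow> steps C [l] D"
| cons: "step C l (Run C'') \<Longrightarrow> steps C'' w D \<Longrightarrow> steps C (l # w) D"


section \<open>Event structures\<close>

record 'e es =
  events :: "'e set"
  ord :: "('e \<times> 'e) set"
  confl :: "('e \<times> 'e) set"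

definition event_structure :: "'e es \<Rightarrow> bool" where
  "event_structure E \<longleftrightarrow>
     partial_order_on (events E) (ord E) \<and>
     (\<forall>e\<in>events E. finite {d. (d, e) \<in> ord E}) \<and>
     confl E \<subseteq> events E \<times> events E \<and> irrefl (confl E) \<and> sym (confl E) \<and>
     (\<forall>e e' e''. (e, e') \<in> confl E \<longrightarrow> (e', e'') \<in> ord E \<longrightarrow> (e, e'') \<in> confl E)"

definition configs :: "'e es \<Rightarrow> 'e set set" where
  "configs E = {x. x \<subseteq> events E \<and>
     (\<forall>e\<in>x. \<forall>e'\<in>x. (e, e') \<notin> confl E) \<and>
     (\<forall>e\<in>x. \<forall>d. (d, e) \<in> ord E \<longrightarrow> d \<in> x)}"

definition max_configs :: "'e es \<Rightarrow> 'e set set" where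
  "max_configs E = {x \<in> configs E. \<forall>y\<in>configs E. x \<subseteq> y \<longrightarrow> y = x}"

definition covers :: "'e es \<Rightarrow> 'e set \<Rightarrow> 'e set \<Rightarrow> bool" where
  "covers E x y \<longleftrightarrow> x \<in> configs E \<and> finite x \<and> y \<in> configs E \<and> finite y \<and>
     (\<exists>e. e \<notin> x \<and> y = insert e x)"

text \<open>The list \<open>xs\<close> is the whole chain, including its initial empty configuration.\<close>

definition covering_chain :: "'e es \<Rightarrow> 'e set list \<Rightarrow> 'e set \<Rightarrow> bool" where
  "covering_chain E xs x \<longleftrightarrow>
     xs \<noteq> [] \<and> hd xs = {} \<and> last xs = x \<and> successively (covers E) xs"

definition added_events :: "'e set list \<Rightarrow> 'e list" where
  "added_events xs = map2 (\<lambda>x y. the_elem (y - x)) xs (tl xs)"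


section \<open>Interpretation of commands\<close>

text \<open>
  A single type of events for all commands: \<open>InL\<close> and \<open>InR\<close> are the injections of disjoint
  unions, and \<open>Copy e x\<close> is the copy of \<open>e\<close> for the maximal configuration \<open>x\<close>.
  A datatype cannot recurse through \<open>set\<close>, so \<open>x\<close> is a finite set; no maximal
  configuration is lost, since only finite event structures arise (\<open>finite_events_interp\<close> below).
\<close>

datatype 'l event =
    Ev 'l
  | InL "'l event"
  | InR "'l event"
  | Copy "'l event" "'l event fset"

primrec event_label :: "'l event \<Rightarrow> 'l" where
  "event_label (Ev l) = l"
| "event_label (InL e) = event_label e"
| "event_label (InR e) = event_label e"
| "event_label (Copy e x) = event_label e"

definition single_es :: "'l \<Rightarrow> 'l event es" where
  "single_es l = \<lparr>events = {Ev l}, ord = {(Ev l, Ev l)}, confl = {}\<rparr>"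

definition seq_ord :: "'l event es \<Rightarrow> 'l event es \<Rightarrow> ('l event \<times> 'l event) set" where
  "seq_ord E1 E2 =
     {(InL e, InL e') | e e'. (e, e') \<in> ord E1} \<union>
     {(Copy e x, Copy e' x) | e e' x. (e, e') \<in> ord E2 \<and> fset x \<in> max_configs E1} \<union>
     {(InL e, Copy e' x) | e e' x. e' \<in> events E2 \<and> fset x \<in> max_configs E1 \<and> e \<in> fset x}"

definition seq_confl0 :: "'l event es \<Rightarrow> 'l event es \<Rightarrow> ('l event \<times> 'l event) set" where
  "seq_confl0 E1 E2 =
     {(InL e, InL e') | e e'. (e, e') \<in> confl E1} \<union>
     {(Copy e x, Copy e' x) | e e' x. (e, e') \<in> confl E2 \<and> fset x \<in> max_configs E1}"

text \<open>
  Conflict in a sequential composition is the least one containing \<open>seq_confl0\<close> that is inherited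
  along the order; in particular copies for incompatible configurations are in conflict.
\<close>

definition seq_es :: "'l event es \<Rightarrow> 'l event es \<Rightarrow> 'l event es" where
  "seq_es E1 E2 =
     \<lparr>events = InL ` events E1 \<union> {Copy e x | e x. e \<in> events E2 \<and> fset x \<in> max_configs E1},
      ord = seq_ord E1 E2,
      confl = {(e, e'). \<exists>d d'. (d, d') \<in> seq_confl0 E1 E2 \<and>
                 (d, e) \<in> seq_ord E1 E2 \<and> (d', e') \<in> seq_ord E1 E2}\<rparr>"

definition par_es :: "'l event es \<Rightarrow> 'l event es \<Rightarrow> 'l event es" where
  "par_es E1 E2 =
     \<lparr>events = InL ` events E1 \<union> InR ` events E2,
      ord = {(InL e, InL e') | e e'. (e, e') \<in> ord E1} \<union>
        {(InR e, InR e') | e e'. (e, e') \<in> ord E2},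
      confl = {(InL e, InL e') | e e'. (e, e') \<in> confl E1} \<union>
        {(InR e, InR e') | e e'. (e, e') \<in> confl E2}\<rparr>"

definition choice_es :: "'l event es \<Rightarrow> 'l event es \<Rightarrow> 'l event es" where
  "choice_es E1 E2 =
     \<lparr>events = InL ` events E1 \<union> InR ` events E2,
      ord = {(InL e, InL e') | e e'. (e, e') \<in> ord E1} \<union>
        {(InR e, InR e') | e e'. (e, e') \<in> ord E2},
      confl = {(InL e, InL e') | e e'. (e, e') \<in> confl E1} \<union>
        {(InR e, InR e') | e e'. (e, e') \<in> confl E2} \<union>
              InL ` events E1 \<times> InR ` events E2 \<union> InR ` events E2 \<times> InL ` events E1\<rparr>"

primrec interp :: "'a com \<Rightarrow> 'a label event es" where
  "interp Skip = single_es Sk"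
| "interp (Act a) = single_es (Lab a)"
| "interp (Seq C1 C2) = seq_es (interp C1) (interp C2)"
| "interp (Choice C1 C2) = choice_es (interp C1) (interp C2)"
| "interp (Par C1 C2) = par_es (interp C1) (interp C2)"

lemma finite_max_configs: "finite (events E) \<Longrightarrow> finite (max_configs E)"
  by (rule finite_subset[of _ "Pow (events E)"]) (auto simp: max_configs_def configs_def)

lemma finite_events_interp: "finite (events (interp C))"
proof (induction C)
  case (Seq C1 C2)
  let ?M = "fset -` max_configs (interp C1)"
  have "finite ?M"
    by (intro finite_vimageI finite_max_configs Seq.IH(1)) (simp add: fset_inject inj_on_def)
  then have "finite ((\<lambda>(e, x). Copy e x) ` (events (interp C2) \<times> ?M))"
    using Seq.IH(2) by blast
  moreover have "{Copy e x | e x. e \<in> events (interp C2) \<and> fset x \<in> max_configs (interp C1)} =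
      (\<lambda>(e, x). Copy e x) ` (events (interp C2) \<times> ?M)"
    by auto
  ultimately show ?case
    using Seq.IH(1) by (simp add: seq_es_def)
qed (auto simp: single_es_def choice_es_def par_es_def)

lemma max_config_interp_fset: "x \<in> max_configs (interp C) \<Longrightarrow> \<exists>y. fset y = x"
  using finite_events_interp[of C]
  by (metis (no_types, lifting) Abs_fset_inverse configs_def finite_subset max_configs_def mem_Collect_eq)

lemma event_structureI:
  assumes "\<And>a b. (a, b) \<in> ord E \<Longrightarrow> a \<in> events E \<and> b \<in> events E"
    and "\<And>a. a \<in> events E \<Longrightarrow> (a, a) \<in> ord E"
    and "\<And>a b c. (a, b) \<in> ord E \<Longrightarrow> (b, c) \<in> ord E \<Longrightarrow> (a, c) \<in> ord E"
    and "\<And>a b. (a, b) \<in> ord E \<Longrightarrow> (b, a) \<in> ord E \<Longrightarrow> a = b"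
    and "\<And>a b. (a, b) \<in> confl E \<Longrightarrow> a \<in> events E \<and> b \<in> events E"
    and "\<And>a. (a, a) \<notin> confl E"
    and "\<And>a b. (a, b) \<in> confl E \<Longrightarrow> (b, a) \<in> confl E"
    and "\<And>a b c. (a, b) \<in> confl E \<Longrightarrow> (b, c) \<in> ord E \<Longrightarrow> (a, c) \<in> confl E"
    and fin: "finite (events E)"
  shows "event_structure E"
proof -
  have "finite {d. (d, e) \<in> ord E}" for e
    by (rule finite_subset[OF _ fin]) (use assms(1) in blast)
  moreover have "ord E \<subseteq> events E \<times> events E" "confl E \<subseteq> events E \<times> events E"
    using assms(1,5) by auto
  moreover have "partial_order_on (events E) (ord E)"
    unfolding partial_order_on_def preorder_on_def refl_on_def trans_def antisym_def
    using assms(1-4) by (intro conjI allI impI ballI subrelI) blast+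
  moreover have "irrefl (confl E)" "sym (confl E)"
    using assms(6,7) by (auto simp: irrefl_def sym_def)
  ultimately show ?thesis
    unfolding event_structure_def using assms(8) by blast
qed

lemma event_structureD:
  assumes "event_structure E"
  shows "\<And>a b. (a, b) \<in> ord E \<Longrightarrow> a \<in> events E \<and> b \<in> events E"
    and "\<And>a. a \<in> events E \<Longrightarrow> (a, a) \<in> ord E"
    and "\<And>a b c. (a, b) \<in> ord E \<Longrightarrow> (b, c) \<in> ord E \<Longrightarrow> (a, c) \<in> ord E"
    and "\<And>a b. (a, b) \<in> ord E \<Longrightarrow> (b, a) \<in> ord E \<Longrightarrow> a = b"
    and "\<And>a b. (a, b) \<in> confl E \<Longrightarrow> a \<in> events E \<and> b \<in> events E"
    and "\<And>a. (a, a) \<notin> confl E"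
    and "\<And>a b. (a, b) \<in> confl E \<Longrightarrow> (b, a) \<in> confl E"
    and "\<And>a b c. (a, b) \<in> confl E \<Longrightarrow> (b, c) \<in> ord E \<Longrightarrow> (a, c) \<in> confl E"
  using assms unfolding event_structure_def partial_order_on_def preorder_on_def
  by (auto simp: refl_on_def irrefl_def dest: transD antisymD symD)

lemma confl_no_upper:
  assumes "event_structure E" "(d, d') \<in> confl E" "(d, a) \<in> ord E" "(d', a) \<in> ord E"
  shows False
proof -
  note D = event_structureD[OF assms(1)]
  have "(a, d) \<in> confl E"
    by (rule D(7), rule D(8)[OF assms(2,4)])
  then show False
    using D(6) D(8)[OF _ assms(3)] by blast
qed

lemma event_structure_seq:
  assumes 1: "event_structure E1" and 2: "event_structure E2"
    and fin: "finite (events (seq_es E1 E2))"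
  shows "event_structure (seq_es E1 E2)"
proof -
  note D1 = event_structureD[OF 1] and D2 = event_structureD[OF 2]
  have max_sub: "x \<in> max_configs E1 \<Longrightarrow> e \<in> x \<Longrightarrow> e \<in> events E1"
    and max_free: "x \<in> max_configs E1 \<Longrightarrow> e \<in> x \<Longrightarrow> e' \<in> x \<Longrightarrow> (e, e') \<notin> confl E1"
    and max_down: "x \<in> max_configs E1 \<Longrightarrow> e \<in> x \<Longrightarrow> (d, e) \<in> ord E1 \<Longrightarrow> d \<in> x" for x e e' d
    by (auto simp: max_configs_def configs_def)
  have trans: "(a, c) \<in> seq_ord E1 E2" if "(a, b) \<in> seq_ord E1 E2" "(b, c) \<in> seq_ord E1 E2" for a b c
    using that by (auto simp: seq_ord_def D2(1)) (meson D1(3) D2(1,3) max_down)+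
  have irr: "(a, a) \<notin> confl (seq_es E1 E2)" for a
  proof
    assume "(a, a) \<in> confl (seq_es E1 E2)"
    then obtain d d' where d: "(d, d') \<in> seq_confl0 E1 E2"
        "(d, a) \<in> seq_ord E1 E2" "(d', a) \<in> seq_ord E1 E2"
      by (auto simp: seq_es_def)
    then show False
      by (auto simp: seq_confl0_def seq_ord_def max_free
          dest: confl_no_upper[OF 1] confl_no_upper[OF 2])
  qed
  show ?thesis
  proof (rule event_structureI)
    show "a \<in> events (seq_es E1 E2) \<and> b \<in> events (seq_es E1 E2)"
      if "(a, b) \<in> ord (seq_es E1 E2)" for a b
      using that D1(1) D2(1) max_sub by (auto simp: seq_es_def seq_ord_def)
    show "(a, a) \<in> ord (seq_es E1 E2)" if "a \<in> events (seq_es E1 E2)" for a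
      using that D1(2) D2(2) by (auto simp: seq_es_def seq_ord_def)
    show "(a, c) \<in> ord (seq_es E1 E2)"
      if "(a, b) \<in> ord (seq_es E1 E2)" "(b, c) \<in> ord (seq_es E1 E2)" for a b c
      using that trans by (auto simp: seq_es_def)
    show "a = b" if "(a, b) \<in> ord (seq_es E1 E2)" "(b, a) \<in> ord (seq_es E1 E2)" for a b
      using that D1(4) D2(4) by (auto simp: seq_es_def seq_ord_def)
    show "a \<in> events (seq_es E1 E2) \<and> b \<in> events (seq_es E1 E2)"
      if "(a, b) \<in> confl (seq_es E1 E2)" for a b
      using that D1(1) D2(1) max_sub by (auto simp: seq_es_def seq_ord_def)
    show "(b, a) \<in> confl (seq_es E1 E2)" if "(a, b) \<in> confl (seq_es E1 E2)" for a b
    proof -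
      have "(d', d) \<in> seq_confl0 E1 E2" if "(d, d') \<in> seq_confl0 E1 E2" for d d'
        using that D1(7) D2(7) by (auto simp: seq_confl0_def)
      then show ?thesis
        using that by (auto simp: seq_es_def)
    qed
    show "(a, c) \<in> confl (seq_es E1 E2)"
      if "(a, b) \<in> confl (seq_es E1 E2)" "(b, c) \<in> ord (seq_es E1 E2)" for a b c
      using that by (auto simp: seq_es_def intro: trans)
  qed (use irr fin in auto)
qed

lemma event_structure_par:
  assumes 1: "event_structure E1" and 2: "event_structure E2"
    and fin: "finite (events (par_es E1 E2))"
  shows "event_structure (par_es E1 E2)"
proof -
  note D1 = event_structureD[OF 1] and D2 = event_structureD[OF 2]
  show ?thesis
    by (rule event_structureI, use fin in
      \<open>auto simp: par_es_def D1(2,6) D2(2,6)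
        dest: D1(1,4,5,7) D2(1,4,5,7)\<close>) (meson D1(3,8) D2(3,8))+
qed

lemma event_structure_choice:
  assumes 1: "event_structure E1" and 2: "event_structure E2"
    and fin: "finite (events (choice_es E1 E2))"
  shows "event_structure (choice_es E1 E2)"
proof -
  note D1 = event_structureD[OF 1] and D2 = event_structureD[OF 2]
  show ?thesis
    by (rule event_structureI, use fin in
      \<open>auto simp: choice_es_def D1(2,6) D2(2,6)
        dest: D1(1,4,5,7) D2(1,4,5,7)\<close>) (meson D1(3,8) D2(3,8))+
qed

lemma event_structure_interp: "event_structure (interp C)"
proof (induction C)
  case (Seq C1 C2)
  then show ?case
    using event_structure_seq finite_events_interp[of "Seq C1 C2"] by auto
next
  case (Choice C1 C2)
  then show ?case
    using event_structure_choice finite_events_interp[of "Choice C1 C2"] by auto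
next
  case (Par C1 C2)
  then show ?case
    using event_structure_par finite_events_interp[of "Par C1 C2"] by auto
qed (auto intro!: event_structureI simp: single_es_def)

end

(* By structural induction on the command: every execution C --w--> D is an enumeration of a
   configuration of [[C]] whose prefixes are configurations, and this configuration is maximal
   if D is the terminated computation. Maximality is what makes the induction work for C1;C2,
   where the events of C2 are copied for the maximal configuration that C1 has reached. *)
theory Submission imports Defs begin

text \<open>A covering chain is encoded by the list of the events it adds, since this list composes
  well under \<open>map\<close>, append and shuffles and carries the labels directly. The values of
  \<open>n\<close> include 0, the empty configuration, and all large \<open>n\<close>, the full
  set.\<close>

definition enum_config :: "'e es \<Rightarrow> 'e list \<Rightarrow> bool" where
  "enum_config E es \<longleftrightarrow> distinct es \<and> (\<forall>n. set (take n es) \<in> configs E)"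

lemma enum_config_in_configs: "enum_config E es \<Longrightarrow> set es \<in> configs E"
  unfolding enum_config_def by (metis order_refl take_all)

lemma empty_in_configs: "{} \<in> configs E"
  by (simp add: configs_def)

lemma enum_config_Nil: "enum_config E []"
  by (simp add: enum_config_def empty_in_configs)

lemma configsD:
  assumes "x \<in> configs E"
  shows "e \<in> x \<Longrightarrow> e \<in> events E"
    and "e \<in> x \<Longrightarrow> e' \<in> x \<Longrightarrow> (e, e') \<notin> confl E"
    and "e \<in> x \<Longrightarrow> (d, e) \<in> ord E \<Longrightarrow> d \<in> x"
  using assms by (auto simp: configs_def)

text \<open>A conflict in the preimage would map to a conflict in \<open>z\<close>, and an event
  below a preimage element maps below an element of \<open>z\<close>. With \<open>f\<close> an
  injection of a component, this cuts a configuration of a composite structure down to that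
  component, which is how maximality is transferred.\<close>

lemma configs_vimage:
  assumes "z \<in> configs F"
    and "\<And>e. f e \<in> events F \<Longrightarrow> e \<in> events E"
    and "\<And>d e. (d, e) \<in> ord E \<Longrightarrow> (f d, f e) \<in> ord F"
    and "\<And>e e'. (e, e') \<in> confl E \<Longrightarrow> (f e, f e') \<in> confl F"
  shows "f -` z \<in> configs E"
  using assms(2-4) configsD[OF assms(1)] unfolding configs_def[of E]
  by (intro CollectI conjI subsetI ballI allI impI notI) (simp_all, blast+)

lemma max_configsI:
  "x \<in> configs E \<Longrightarrow> (\<And>z. z \<in> configs E \<Longrightarrow> x \<subseteq> z \<Longrightarrow> z = x) \<Longrightarrow> x \<in> max_configs E"
  by (simp add: max_configs_def)

lemma max_configsD:
  assumes "x \<in> max_configs E"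
  shows "x \<in> configs E" and "y \<in> configs E \<Longrightarrow> x \<subseteq> y \<Longrightarrow> y = x"
  using assms by (auto simp: max_configs_def)

section \<open>Covering chains from enumerations\<close>

text \<open>The prefixes of \<open>es\<close> are the chain. Distinctness makes consecutive prefixes
  differ by exactly one event, so \<open>the_elem\<close> recovers it.\<close>

lemma covering_chain_of_enum:
  assumes "enum_config E es"
  defines "xs \<equiv> map (\<lambda>n. set (take n es)) [0..<Suc (length es)]"
  shows "covering_chain E xs (set es)" and "added_events xs = es"
proof -
  have add: "es ! i \<notin> set (take i es)" if "i < length es" for i
    using assms(1) that by (auto simp: enum_config_def in_set_conv_nth nth_eq_iff_index_eq)
  have len: "length xs = Suc (length es)"
    by (simp add: xs_def)
  \<comment> \<open>Without removing \<open>upt_Suc\<close>, simplification would split off the last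
    index and hide the list from the indexing rules.\<close>
  have nth: "xs ! i = set (take i es)" if "i \<le> length es" for i
    using that by (simp add: xs_def del: upt_Suc)
  have Suc: "set (take (Suc i) es) = insert (es ! i) (set (take i es))" if "i < length es" for i
    using that by (simp add: take_Suc_conv_app_nth)
  have covers: "covers E (xs ! i) (xs ! Suc i)" if "i < length es" for i
    unfolding covers_def using that assms(1) add[OF that] Suc[OF that]
    by (simp add: nth enum_config_def) (metis Suc)
  have "hd xs = {}"
    using nth[of 0] len by (simp add: hd_conv_nth xs_def)
  moreover have "last xs = set es"
    by (simp add: xs_def)
  moreover have "xs \<noteq> []"
    using len by auto
  moreover have "successively (covers E) xs"
    using covers len by (simp add: successively_conv_nth)
  ultimately show "covering_chain E xs (set es)"
    by (simp add: covering_chain_def)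
  show "added_events xs = es"
  proof (rule nth_equalityI)
    show "length (added_events xs) = length es"
      by (simp add: added_events_def len)
    fix i assume "i < length (added_events xs)"
    then have i: "i < length es"
      by (simp add: added_events_def len)
    have "xs ! Suc i - xs ! i = {es ! i}"
      using i add[OF i] Suc[OF i] by (auto simp: nth)
    then show "added_events xs ! i = es ! i"
      using i len by (simp add: added_events_def nth_tl)
  qed
qed

section \<open>Executions of composite commands\<close>

inductive_cases step_SkipE: "step Skip l D"
inductive_cases step_ActE: "step (Act a) l D"
inductive_cases step_SeqE: "step (Seq C1 C2) l D"
inductive_cases step_ChoiceE: "step (Choice C1 C2) l D"
inductive_cases step_ParE: "step (Par C1 C2) l D"

lemma steps_Skip: "steps Skip w D \<Longrightarrow> w = [Sk] \<and> D = Tick"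
  by (erule steps.cases) (auto elim: step_SkipE)

lemma steps_Act: "steps (Act a) w D \<Longrightarrow> w = [Lab a] \<and> D = Tick"
  by (erule steps.cases) (auto elim: step_ActE)

lemma steps_Choice: "steps (Choice C1 C2) w D \<Longrightarrow> steps C1 w D \<or> steps C2 w D"
  by (erule steps.cases) (auto elim!: step_ChoiceE intro: steps.intros)

text \<open>As long as \<open>C1\<close> has not terminated, the residual is again a
  \<open>Seq\<close>, so the word splits where \<open>C1\<close> ticks. A word ending exactly at
  that tick falls under the first disjunct, with \<open>D1 = Tick\<close> and
  \<open>D = Run C2\<close>, because \<open>steps\<close> has no empty word to leave for
  \<open>C2\<close>.\<close>

lemma steps_Seq:
  assumes "steps (Seq C1 C2) w D"
  shows "D \<noteq> Tick \<and> (\<exists>D1. steps C1 w D1) \<or>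
    (\<exists>u v. w = u @ v \<and> steps C1 u Tick \<and> steps C2 v D)"
  using assms
proof (induction "Seq C1 C2" w D arbitrary: C1 rule: steps.induct)
  case (single l D)
  then show ?case
    by (auto elim!: step_SeqE intro: steps.intros)
next
  case (cons l C'' w D)
  from cons.hyps(1) show ?case
  proof (rule step_SeqE)
    assume "Run C'' = Run C2" "step C1 l Tick"
    then have "l # w = [l] @ w \<and> steps C1 [l] Tick \<and> steps C2 w D"
      using cons.hyps(2) by (auto intro: steps.single)
    then show ?thesis
      by blast
  next
    fix C1' assume C1': "Run C'' = Run (Seq C1' C2)" "step C1 l (Run C1')"
    then consider D1 where "D \<noteq> Tick" "steps C1' w D1"
      | u v where "w = u @ v" "steps C1' u Tick" "steps C2 v D"
      using cons.hyps(3)[of C1'] by auto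
    then show ?thesis
    proof cases
      case 1
      then show ?thesis
        using C1'(2) by (blast intro: steps.cons)
    next
      case 2
      then have "l # w = (l # u) @ v \<and> steps C1 (l # u) Tick \<and> steps C2 v D"
        using C1'(2) by (auto intro: steps.cons)
      then show ?thesis
        by blast
    qed
  qed
qed

text \<open>The reflexive closure of \<open>steps\<close>: inside a parallel composition one
  component may not have moved at all.\<close>

definition steps0 :: "'a com \<Rightarrow> 'a label list \<Rightarrow> 'a outcome \<Rightarrow> bool" where
  "steps0 C w D \<longleftrightarrow> w = [] \<and> D = Run C \<or> steps C w D"

lemma steps0_Nil: "steps0 C [] (Run C)"
  by (simp add: steps0_def)

lemma steps0_single: "step C l D \<Longrightarrow> steps0 C [l] D"
  by (simp add: steps0_def steps.single)

lemma steps0_cons: "step C l (Run C') \<Longrightarrow> steps0 C' w D \<Longrightarrow> steps0 C (l # w) D"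
  by (auto simp: steps0_def intro: steps.intros)

text \<open>Each label is charged to the side that makes the move. The two residual outcomes matter
  only when the whole computation terminates, and then both sides must have ticked.\<close>

lemma steps_Par:
  assumes "steps (Par C1 C2) w D"
  shows "\<exists>u v D1 D2. w \<in> shuffles u v \<and> steps0 C1 u D1 \<and> steps0 C2 v D2 \<and>
    (D = Tick \<longrightarrow> D1 = Tick \<and> D2 = Tick)"
  using assms
proof (induction "Par C1 C2" w D arbitrary: C1 C2 rule: steps.induct)
  case (single l D)
  have nil: "[l] \<in> shuffles [l] []" "[l] \<in> shuffles [] [l]"
    by simp_all
  from single show ?case
    by (rule step_ParE) (use nil steps0_Nil steps0_single outcome.distinct(1) in metis)+
next
  case (cons l C'' w D)
  from cons.hyps(1) show ?case
  proof (rule step_ParE)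
    fix C1' assume C1': "Run C'' = Run (Par C1' C2)" "step C1 l (Run C1')"
    then show ?thesis
      using cons.hyps(3)[of C1' C2] by (fast intro: Cons_in_shuffles_leftI steps0_cons)
  next
    fix C2' assume C2': "Run C'' = Run (Par C1 C2')" "step C2 l (Run C2')"
    then show ?thesis
      using cons.hyps(3)[of C1 C2'] by (fast intro: Cons_in_shuffles_rightI steps0_cons)
  next
    \<comment> \<open>The parallel composition has disappeared: \<open>C1\<close> contributes only
      this label, and the rest of the word is an execution of \<open>C2\<close> alone.\<close>
    assume "Run C'' = Run C2" "step C1 l Tick"
    then have "steps0 C1 [l] Tick" "steps0 C2 w D" "l # w \<in> shuffles [l] w"
      using cons.hyps(2) by (auto simp: steps0_def Cons_in_shuffles_leftI intro: steps.single)
    then show ?thesis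
      by blast
  next
    assume "Run C'' = Run C1" "step C2 l Tick"
    then have "steps0 C2 [l] Tick" "steps0 C1 w D" "l # w \<in> shuffles w [l]"
      using cons.hyps(2) by (auto simp: steps0_def Cons_in_shuffles_rightI intro: steps.single)
    then show ?thesis
      by blast
  qed
qed

section \<open>Configurations of composite event structures\<close>

lemma max_configs_single: "{Ev l} \<in> max_configs (single_es l)"
  by (auto simp: max_configs_def configs_def single_es_def)

lemma enum_config_single: "enum_config (single_es l) [Ev l]"
  using max_configsD(1)[OF max_configs_single[of l]]
  by (auto simp: enum_config_def empty_in_configs take_Cons')

section \<open>Sums\<close>

lemma configs_choice:
  shows "x \<in> configs E1 \<Longrightarrow> InL ` x \<in> configs (choice_es E1 E2)"
    and "x \<in> configs E2 \<Longrightarrow> InR ` x \<in> configs (choice_es E1 E2)"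
  by (auto simp: choice_es_def configs_def)

lemma enum_config_choice:
  shows "enum_config E1 es \<Longrightarrow> enum_config (choice_es E1 E2) (map InL es)"
    and "enum_config E2 es \<Longrightarrow> enum_config (choice_es E1 E2) (map InR es)"
  by (auto simp: enum_config_def take_map distinct_map inj_on_def configs_choice)

lemma configs_vimage_choice:
  assumes "z \<in> configs (choice_es E1 E2)"
  shows "InL -` z \<in> configs E1" and "InR -` z \<in> configs E2"
  by (rule configs_vimage[OF assms]; auto simp: choice_es_def)+

text \<open>The empty set has to be excluded: it is maximal in an empty summand, but not in the sum.\<close>

lemma max_configs_choice_left:
  assumes "x \<in> max_configs E1" "x \<noteq> {}"
  shows "InL ` x \<in> max_configs (choice_es E1 E2)"
proof -
  have "z = InL ` x" if z: "z \<in> configs (choice_es E1 E2)" "InL ` x \<subseteq> z" for z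
  proof -
    have "InL -` z = x"
      using max_configsD(2)[OF assms(1) configs_vimage_choice(1)[OF z(1)]] z(2) by auto
    \<comment> \<open>Some left event \<open>a\<close> lies in \<open>x\<close>, and every right
      event conflicts with it, so \<open>z\<close> has none.\<close>
    moreover have "e \<in> range InL" if e: "e \<in> z" for e
    proof -
      obtain a where "a \<in> x" using assms(2) by blast
      with z(2) have a: "InL a \<in> z" by blast
      show ?thesis
        using configsD(1)[OF z(1) e] configsD(1)[OF z(1) a] configsD(2)[OF z(1) e a]
        by (auto simp: choice_es_def)
    qed
    ultimately show ?thesis
      by auto
  qed
  then show ?thesis
    by (rule max_configsI[OF configs_choice(1)[OF max_configsD(1)[OF assms(1)]]])
qed

lemma max_configs_choice_right:
  assumes "x \<in> max_configs E2" "x \<noteq> {}"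
  shows "InR ` x \<in> max_configs (choice_es E1 E2)"
proof -
  have "z = InR ` x" if z: "z \<in> configs (choice_es E1 E2)" "InR ` x \<subseteq> z" for z
  proof -
    have "InR -` z = x"
      using max_configsD(2)[OF assms(1) configs_vimage_choice(2)[OF z(1)]] z(2) by auto
    moreover have "e \<in> range InR" if e: "e \<in> z" for e
    proof -
      obtain a where "a \<in> x" using assms(2) by blast
      with z(2) have a: "InR a \<in> z" by blast
      show ?thesis
        using configsD(1)[OF z(1) e] configsD(1)[OF z(1) a] configsD(2)[OF z(1) e a]
        by (auto simp: choice_es_def)
    qed
    ultimately show ?thesis
      by auto
  qed
  then show ?thesis
    by (rule max_configsI[OF configs_choice(2)[OF max_configsD(1)[OF assms(1)]]])
qed

section \<open>Parallel composition and shuffles\<close>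

lemma configs_par:
  "x \<in> configs E1 \<Longrightarrow> y \<in> configs E2 \<Longrightarrow> InL ` x \<union> InR ` y \<in> configs (par_es E1 E2)"
  by (auto simp: par_es_def configs_def)

lemma configs_vimage_par:
  assumes "z \<in> configs (par_es E1 E2)"
  shows "InL -` z \<in> configs E1" and "InR -` z \<in> configs E2"
  by (rule configs_vimage[OF assms]; auto simp: par_es_def)+

text \<open>A configuration of the parallel composition is determined by its preimages under the two
  injections, so maximality can be checked in each component.\<close>

lemma max_configs_par:
  assumes x: "x \<in> max_configs E1" and y: "y \<in> max_configs E2"
  shows "InL ` x \<union> InR ` y \<in> max_configs (par_es E1 E2)"
proof -
  have "z = InL ` x \<union> InR ` y" if z: "z \<in> configs (par_es E1 E2)" "InL ` x \<union> InR ` y \<subseteq> z" for z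
  proof -
    have "InL -` z = x" "InR -` z = y"
      by (rule max_configsD(2)[OF x configs_vimage_par(1)[OF z(1)]]
          max_configsD(2)[OF y configs_vimage_par(2)[OF z(1)]]; use z(2) in blast)+
    moreover have "z \<subseteq> range InL \<union> range InR"
      by (auto simp: par_es_def dest!: configsD(1)[OF z(1)])
    ultimately show ?thesis
      by auto
  qed
  then show ?thesis
    by (rule max_configsI[OF configs_par[OF max_configsD(1)[OF x] max_configsD(1)[OF y]]])
qed

text \<open>Whichever list supplies the first letter has its prefix lengthened by one. This reduces
  prefixes of an interleaving to prefixes of the two enumerations.\<close>

lemma take_shuffles:
  "zs \<in> shuffles xs ys \<Longrightarrow> \<exists>i j. take n zs \<in> shuffles (take i xs) (take j ys)"
proof (induction zs arbitrary: xs ys n)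
  case Nil
  then show ?case
    by (auto intro: exI[of _ 0])
next
  case (Cons z zs)
  show ?case
  proof (cases n)
    case 0
    then show ?thesis
      by (auto intro: exI[of _ 0])
  next
    case (Suc m)
    from Cons.prems consider xs' where "xs = z # xs'" "zs \<in> shuffles xs' ys"
      | ys' where "ys = z # ys'" "zs \<in> shuffles xs ys'"
      by (cases xs; cases ys) (auto simp: Cons_in_shuffles_iff)
    then show ?thesis
    proof cases
      case 1
      obtain i j where "take m zs \<in> shuffles (take i xs') (take j ys)"
        using Cons.IH[OF 1(2)] by blast
      then have "take n (z # zs) \<in> shuffles (take (Suc i) xs) (take j ys)"
        using 1(1) Suc by (simp add: Cons_in_shuffles_leftI)
      then show ?thesis by blast
    next
      case 2
      obtain i j where "take m zs \<in> shuffles (take i xs) (take j ys')"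
        using Cons.IH[OF 2(2)] by blast
      then have "take n (z # zs) \<in> shuffles (take i xs) (take (Suc j) ys)"
        using 2(1) Suc by (simp add: Cons_in_shuffles_rightI)
      then show ?thesis by blast
    qed
  qed
qed

text \<open>Reading \<open>w\<close> from left to right, each letter is replaced by the element
  whose image supplied it. Thus an interleaving of label words lifts to one of the underlying
  events.\<close>

lemma map_shuffles:
  "w \<in> shuffles (map f xs) (map f ys) \<Longrightarrow> \<exists>zs\<in>shuffles xs ys. map f zs = w"
proof (induction w arbitrary: xs ys)
  case Nil
  then show ?case by auto
next
  case (Cons l w)
  from Cons.prems consider x xs' where "xs = x # xs'" "f x = l" "w \<in> shuffles (map f xs') (map f ys)"
    | y ys' where "ys = y # ys'" "f y = l" "w \<in> shuffles (map f xs) (map f ys')"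
    by (cases xs; cases ys) (auto simp: Cons_in_shuffles_iff)
  then show ?case
  proof cases
    case 1
    with Cons.IH[OF 1(3)] show ?thesis
      by (metis Cons_in_shuffles_leftI list.simps(9))
  next
    case 2
    with Cons.IH[OF 2(3)] show ?thesis
      by (metis Cons_in_shuffles_rightI list.simps(9))
  qed
qed

lemma enum_config_par:
  assumes 1: "enum_config E1 es1" and 2: "enum_config E2 es2"
    and es: "es \<in> shuffles (map InL es1) (map InR es2)"
  shows "enum_config (par_es E1 E2) es"
proof -
  have "distinct es"
    using 1 2 es by (intro distinct_disjoint_shuffles[OF _ _ _ es])
      (auto simp: enum_config_def distinct_map inj_on_def)
  moreover have "set (take n es) \<in> configs (par_es E1 E2)" for n
  proof -
    obtain i j where "take n es \<in> shuffles (map InL (take i es1)) (map InR (take j es2))"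
      using take_shuffles[OF es, of n] by (auto simp: take_map)
    then have "set (take n es) = InL ` set (take i es1) \<union> InR ` set (take j es2)"
      by (simp add: set_shuffles)
    then show ?thesis
      using 1 2 by (simp add: enum_config_def configs_par)
  qed
  ultimately show ?thesis
    by (simp add: enum_config_def)
qed

section \<open>Sequential composition\<close>

lemma configs_seqI:
  assumes "z \<subseteq> events (seq_es E1 E2)"
    and "\<And>e e'. e \<in> z \<Longrightarrow> e' \<in> z \<Longrightarrow> (e, e') \<notin> seq_confl0 E1 E2"
    and "\<And>e d. e \<in> z \<Longrightarrow> (d, e) \<in> seq_ord E1 E2 \<Longrightarrow> d \<in> z"
  shows "z \<in> configs (seq_es E1 E2)"
  \<comment> \<open>An inherited conflict inside \<open>z\<close> comes from a generating one below
    it, which down-closure puts inside \<open>z\<close> as well; so only \<open>seq_confl0\<close>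
    has to be tested.\<close>
  using assms by (auto simp: configs_def seq_es_def)

lemma configs_seq_left:
  "x \<in> configs E1 \<Longrightarrow> InL ` x \<in> configs (seq_es E1 E2)"
  by (rule configs_seqI) (auto simp: seq_es_def seq_confl0_def seq_ord_def dest: configsD)

lemma configs_seq:
  assumes "fset X \<in> max_configs E1" "y \<in> configs E2"
  shows "InL ` fset X \<union> (\<lambda>e. Copy e X) ` y \<in> configs (seq_es E1 E2)"
  by (rule configs_seqI)
    (use assms(1) configsD[OF assms(2)] configsD[OF max_configsD(1)[OF assms(1)]] in
      \<open>auto simp: seq_es_def seq_confl0_def seq_ord_def\<close>)

lemma enum_config_seq_left:
  "enum_config E1 es \<Longrightarrow> enum_config (seq_es E1 E2) (map InL es)"
  by (auto simp: enum_config_def take_map distinct_map inj_on_def configs_seq_left)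

lemma enum_config_seq:
  assumes 1: "enum_config E1 es1" and 2: "enum_config E2 es2"
    and X: "set es1 = fset X" "fset X \<in> max_configs E1"
  shows "enum_config (seq_es E1 E2) (map InL es1 @ map (\<lambda>e. Copy e X) es2)"
proof -
  have "set (take n (map InL es1 @ map (\<lambda>e. Copy e X) es2)) \<in> configs (seq_es E1 E2)" for n
  \<comment> \<open>A copy has all of \<open>X\<close> below it, so copies may appear only once
    \<open>es1\<close> is exhausted: a prefix either lies within \<open>es1\<close> or consists of
    all of \<open>X\<close> and copies of a prefix of \<open>es2\<close>.\<close>
  proof (cases "n \<le> length es1")
    case True
    then show ?thesis
      using 1 by (simp add: take_map configs_seq_left enum_config_def)
  next
    case False
    then show ?thesis
      using 2 X configs_seq[OF X(2), of "set (take (n - length es1) es2)" E2]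
      by (simp add: take_map enum_config_def)
  qed
  moreover have "distinct (map InL es1 @ map (\<lambda>e. Copy e X) es2)"
    using 1 2 by (auto simp: enum_config_def distinct_map inj_on_def)
  ultimately show ?thesis
    by (simp add: enum_config_def)
qed

text \<open>In a larger configuration \<open>z\<close>, maximality of \<open>X\<close> fixes the
  left events. Any copy in \<open>z\<close> brings its whole index into the left part, so that index
  is \<open>X\<close>; maximality of \<open>y\<close> then fixes the copies.\<close>

lemma max_configs_seq:
  assumes E1: "event_structure E1" and E2: "event_structure E2"
    and X: "fset X \<in> max_configs E1" and y: "y \<in> max_configs E2"
  shows "InL ` fset X \<union> (\<lambda>e. Copy e X) ` y \<in> max_configs (seq_es E1 E2)" (is "?x \<in> _")
proof -
  have "z = ?x" if z: "z \<in> configs (seq_es E1 E2)" "?x \<subseteq> z" for z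
  proof -
    note Z = configsD[OF z(1)]
    have ord: "d \<in> z" if "e \<in> z" "(d, e) \<in> seq_ord E1 E2" for d e
      using Z(3)[of e d] that by (simp add: seq_es_def)
    have "InL -` z \<in> configs E1"
    proof (rule configs_vimage[OF z(1)])
      show "(InL e, InL e') \<in> confl (seq_es E1 E2)" if "(e, e') \<in> confl E1" for e e'
      proof -
        \<comment> \<open>Reflexivity of the order, available because \<open>E1\<close> is an event
          structure, turns a generating conflict into a conflict of the composition.\<close>
        have "(InL e, InL e') \<in> seq_confl0 E1 E2"
          "(InL e, InL e) \<in> seq_ord E1 E2" "(InL e', InL e') \<in> seq_ord E1 E2"
          using that event_structureD(2,5)[OF E1] by (auto simp: seq_confl0_def seq_ord_def)
        then show ?thesis
          by (auto simp: seq_es_def)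
      qed
    qed (auto simp: seq_es_def seq_ord_def)
    then have L: "InL -` z = fset X"
      using z(2) by (intro max_configsD(2)[OF X]) auto
    have "(\<lambda>e. Copy e X) -` z \<in> configs E2"
    proof (rule configs_vimage[OF z(1)])
      show "(Copy e X, Copy e' X) \<in> confl (seq_es E1 E2)" if "(e, e') \<in> confl E2" for e e'
      proof -
        have "(Copy e X, Copy e' X) \<in> seq_confl0 E1 E2"
          "(Copy e X, Copy e X) \<in> seq_ord E1 E2" "(Copy e' X, Copy e' X) \<in> seq_ord E1 E2"
          using that X event_structureD(2,5)[OF E2] by (auto simp: seq_confl0_def seq_ord_def)
        then show ?thesis
          by (auto simp: seq_es_def)
      qed
    qed (use X in \<open>auto simp: seq_es_def seq_ord_def\<close>)
    then have R: "(\<lambda>e. Copy e X) -` z = y"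
      using z(2) by (intro max_configsD(2)[OF y]) auto
    have copies: "X' = X" if e: "Copy e X' \<in> z" for e X'
    proof -
      have X': "fset X' \<in> max_configs E1" "e \<in> events E2"
        using Z(1)[OF e] by (auto simp: seq_es_def)
      then have "InL d \<in> z" if "d \<in> fset X'" for d
        using that ord[OF e, of "InL d"] by (auto simp: seq_ord_def)
      then have "fset X' \<subseteq> fset X"
        using L by auto
      then show ?thesis
        \<comment> \<open>Here it is the maximality of the smaller set \<open>X'\<close> that forces
          equality.\<close>
        using max_configsD(2)[OF X'(1) max_configsD(1)[OF X]] by (simp add: fset_inject)
    qed
    show ?thesis
    proof (rule antisym[OF _ z(2)], rule subsetI)
      fix e assume e: "e \<in> z"
      from Z(1)[OF e] show "e \<in> ?x"
        using e L R copies by (auto simp: seq_es_def)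
    qed
  qed
  then show ?thesis
    by (rule max_configsI[OF configs_seq[OF X max_configsD(1)[OF y]]])
qed

section \<open>Executions as enumerations of configurations\<close>

lemma enum_config_of_steps:
  assumes "steps C w D"
  shows "\<exists>es. enum_config (interp C) es \<and> map event_label es = w \<and>
    (D = Tick \<longrightarrow> set es \<in> max_configs (interp C))"
  using assms
proof (induction C arbitrary: w D)
  case Skip
  then have "w = [Sk]" by (simp add: steps_Skip)
  then show ?case
    by (intro exI[of _ "[Ev Sk]"]) (simp add: enum_config_single max_configs_single)
next
  case (Act a)
  then have "w = [Lab a]" by (simp add: steps_Act)
  then show ?case
    by (intro exI[of _ "[Ev (Lab a)]"]) (simp add: enum_config_single max_configs_single)
next
  case (Seq C1 C2)
  from steps_Seq[OF Seq.prems] consider D1 where "D \<noteq> Tick" "steps C1 w D1"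
    | u v where "w = u @ v" "steps C1 u Tick" "steps C2 v D"
    by blast
  then show ?case
  proof cases
    case 1
    obtain es where "enum_config (interp C1) es" "map event_label es = w"
      using Seq.IH(1)[OF 1(2)] by blast
    \<comment> \<open>\<open>D\<close> is not \<open>Tick\<close>, so maximality is not demanded,
      even if \<open>C1\<close> itself has just terminated.\<close>
    then show ?thesis
      using 1(1) by (intro exI[of _ "map InL es"]) (auto simp: enum_config_seq_left)
  next
    case 2
    obtain es1 where es1: "enum_config (interp C1) es1" "map event_label es1 = u"
        "set es1 \<in> max_configs (interp C1)"
      using Seq.IH(1)[OF 2(2)] by blast
    obtain es2 where es2: "enum_config (interp C2) es2" "map event_label es2 = v"
        "D = Tick \<longrightarrow> set es2 \<in> max_configs (interp C2)"
      using Seq.IH(2)[OF 2(3)] by blast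
    \<comment> \<open>Copies are indexed by finite sets; finiteness of the interpretation provides
      the index for the maximal configuration reached by \<open>C1\<close>.\<close>
    obtain X where X: "set es1 = fset X" "fset X \<in> max_configs (interp C1)"
      using max_config_interp_fset[OF es1(3)] es1(3) by metis
    have "set (map InL es1 @ map (\<lambda>e. Copy e X) es2) \<in> max_configs (interp (Seq C1 C2))"
      if "D = Tick"
      using max_configs_seq[OF event_structure_interp event_structure_interp X(2)] es2(3) that X(1)
      by simp
    moreover have "enum_config (interp (Seq C1 C2)) (map InL es1 @ map (\<lambda>e. Copy e X) es2)"
      using enum_config_seq[OF es1(1) es2(1) X] by simp
    moreover have "map event_label (map InL es1 @ map (\<lambda>e. Copy e X) es2) = w"
      using es1(2) es2(2) 2(1) by (auto simp: comp_def)
    ultimately show ?thesis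
      by blast
  qed
next
  case (Choice C1 C2)
  \<comment> \<open>A non-empty word yields a non-empty configuration, the side condition for
    maximality in a sum.\<close>
  from Choice.prems have "w \<noteq> []"
    by (auto elim: steps.cases)
  from steps_Choice[OF Choice.prems] show ?case
  proof
    assume "steps C1 w D"
    then obtain es where es: "enum_config (interp C1) es" "map event_label es = w"
        "D = Tick \<longrightarrow> set es \<in> max_configs (interp C1)"
      using Choice.IH(1) by blast
    with \<open>w \<noteq> []\<close> have "set es \<noteq> {}" by auto
    with es show ?thesis
      by (intro exI[of _ "map InL es"]) (auto simp: enum_config_choice max_configs_choice_left)
  next
    assume "steps C2 w D"
    then obtain es where es: "enum_config (interp C2) es" "map event_label es = w"
        "D = Tick \<longrightarrow> set es \<in> max_configs (interp C2)"
      using Choice.IH(2) by blast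
    with \<open>w \<noteq> []\<close> have "set es \<noteq> {}" by auto
    with es show ?thesis
      by (intro exI[of _ "map InR es"]) (auto simp: enum_config_choice max_configs_choice_right)
  qed
next
  case (Par C1 C2)
  obtain u v D1 D2 where uv: "w \<in> shuffles u v" "steps0 C1 u D1" "steps0 C2 v D2"
      "D = Tick \<longrightarrow> D1 = Tick \<and> D2 = Tick"
    using steps_Par[OF Par.prems] by blast
  \<comment> \<open>If \<open>C1\<close> has not moved, \<open>es1\<close> is the empty enumeration,
    and \<open>D1\<close> is a \<open>Run\<close>, so maximality is not claimed.\<close>
  obtain es1 where es1: "enum_config (interp C1) es1" "map event_label es1 = u"
      "D1 = Tick \<longrightarrow> set es1 \<in> max_configs (interp C1)"
    using Par.IH(1)[of u D1] uv(2) enum_config_Nil by (fastforce simp: steps0_def)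
  obtain es2 where es2: "enum_config (interp C2) es2" "map event_label es2 = v"
      "D2 = Tick \<longrightarrow> set es2 \<in> max_configs (interp C2)"
    using Par.IH(2)[of v D2] uv(3) enum_config_Nil by (fastforce simp: steps0_def)
  have "map event_label (map InL es1) = u" "map event_label (map InR es2) = v"
    using es1(2) es2(2) by auto
  then obtain es where es: "es \<in> shuffles (map InL es1) (map InR es2)" "map event_label es = w"
    using map_shuffles[of w event_label "map InL es1" "map InR es2"] uv(1) by metis
  have "set es \<in> max_configs (interp (Par C1 C2))" if "D = Tick"
    using max_configs_par es1(3) es2(3) uv(4) that set_shuffles[OF es(1)] by simp
  then show ?case
    using enum_config_par[OF es1(1) es2(1) es(1)] es(2) by auto
qed

theorem mainTheorem1:
  fixes C :: "'a com" and C' :: "'a outcome" and \<omega> :: "'a label list"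
  assumes "\<omega> \<noteq> []"
    and "steps C \<omega> C'"
  shows "\<exists>x xs. x \<in> configs (interp C) \<and> finite x \<and>
           covering_chain (interp C) xs x \<and>
           map event_label (added_events xs) = \<omega>"
proof -
  obtain es where "enum_config (interp C) es" "map event_label es = \<omega>"
    using enum_config_of_steps[OF assms(2)] by blast
  then show ?thesis
    using covering_chain_of_enum[of "interp C" es] enum_config_in_configs[of "interp C" es]
    by (metis List.finite_set)
qed

end
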